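(* Let $A\subset\mathbb{R}^n$ be a convex compact subset and let $\mathcal{L}\subset\mathbb{R}^n$ be a linear subspace. Suppose that one of the following properties is satisfied: (1) $\dim\mathcal{L}=n-1$, or (2) $A$ is a $P$-set. Then the set-valued mapping $F(z)=(z+\mathcal{L})\cap A$ is continuous in the Hausdorff metric on its domain $\operatorname{dom}F=\{z\in\mathbb{R}^n : F(z)\neq\emptyset\}=A+\mathcal{L}$.
   Context: $\mathbb{R}^n$ carries the Euclidean inner product $\langle\cdot,\cdot\rangle$. For a unit vector $q\in\mathbb{R}^n$ let $L(q)=\{z\in\mathbb{R}^n:\langle q,z\rangle=0\}$; each $z\in\mathbb{R}^n$ is written $z=x+\mu q=(x,\mu)$ with $x\in L(q)$, $\mu\in\mathbb{R}$, and $P_q:\mathbb{R}^n\to L(q)$, $P_q z=x$, is the orthogonal projection. For a convex compact $A\subset\mathbb{R}^n$ define $f_{A,q}:P_qA\to\mathbb{R}$ by $f_{A,q}(x)=\min\{\mu : (x,\mu)\in A\}$. A convex compact set $A\subset\mathbb{R}^n$ is called a $P$-set if for every unit vector $q$ the function $f_{A,q}$ is continuous on $P_qA$. The Hausdorff distance is $h(A,B)=\inf\{h>0 : A\subset B+B_h(0),\ B\subset A+B_h(0)\}$, where $B_h(0)$ is the closed ball of radius $h$ centered at $0$. *)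

theory Defs
  imports "HOL-Analysis.Analysis"
begin

definition hyperplane_orth :: "'a::real_inner \<Rightarrow> 'a set" where
  "hyperplane_orth q = {z. q \<bullet> z = 0}"

(* For a unit vector q this is the orthogonal projection onto hyperplane_orth q;
   see proj_orth_decomposition below. *)
definition proj_orth :: "'a::real_inner \<Rightarrow> 'a \<Rightarrow> 'a" where
  "proj_orth q z = z - (q \<bullet> z) *\<^sub>R q"

lemma proj_orth_decomposition:
  fixes q z x :: "'a::real_inner" and \<mu> :: real
  assumes "norm q = 1"
  shows "x \<in> hyperplane_orth q \<and> z = x + \<mu> *\<^sub>R q \<longleftrightarrow> x = proj_orth q z \<and> \<mu> = q \<bullet> z"
proof -
  have "q \<bullet> q = 1"
    using assms by (simp add: norm_eq_1)
  then show ?thesis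
    by (auto simp: hyperplane_orth_def proj_orth_def inner_diff_right inner_add_right)
qed

(* LEAST on the reals is the minimum whenever it is attained, which is the case for compact A
   and x in proj_orth q ` A; outside that set the value is irrelevant. *)
definition lower_fun :: "'a::real_inner set \<Rightarrow> 'a \<Rightarrow> 'a \<Rightarrow> real" where
  "lower_fun A q x = (LEAST \<mu>. x + \<mu> *\<^sub>R q \<in> A)"

definition P_set :: "'a::real_inner set \<Rightarrow> bool" where
  "P_set A \<longleftrightarrow> convex A \<and> compact A \<and>
     (\<forall>q. norm q = 1 \<longrightarrow> continuous_on (proj_orth q ` A) (lower_fun A q))"

(* The sums are Minkowski sums. This is a genuine distance on nonempty bounded closed sets;
   on other arguments the infimum may be taken over the empty set and is then meaningless. *)
definition hausdorff_dist :: "'a::real_normed_vector set \<Rightarrow> 'a set \<Rightarrow> real" where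
  "hausdorff_dist A B = Inf {h. h > 0 \<and> A \<subseteq> B + cball 0 h \<and> B \<subseteq> A + cball 0 h}"

definition hausdorff_continuous_on ::
    "'a::metric_space set \<Rightarrow> ('a \<Rightarrow> 'b::real_normed_vector set) \<Rightarrow> bool" where
  "hausdorff_continuous_on D F \<longleftrightarrow>
     (\<forall>z\<in>D. \<forall>\<epsilon>>0. \<exists>\<delta>>0. \<forall>w\<in>D. dist w z < \<delta> \<longrightarrow> hausdorff_dist (F w) (F z) < \<epsilon>)"

definition subspace_section :: "'a::real_vector set \<Rightarrow> 'a set \<Rightarrow> 'a \<Rightarrow> 'a set" where
  "subspace_section A L z = ((+) z ` L) \<inter> A"

definition set_valued_dom :: "('a \<Rightarrow> 'b set) \<Rightarrow> 'a set" where
  "set_valued_dom F = {z. F z \<noteq> {}}"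

end

theory Submission
  imports Defs
begin

text \<open>
  Upper semicontinuity of the sections \<open>(z + L) \<inter> A\<close> is automatic: \<open>A\<close> is compact and \<open>L\<close> is
  closed, so limits of points in nearby sections lie in the limiting section.  All the content is
  in lower semicontinuity: each point \<open>a\<close> of a section must be approximated from the nearby ones.

  The property used for this, \<open>lifts_sequences A L\<close>, starts from points \<open>b k \<in> A\<close> that converge to
  some point \<open>l\<close> of the section through \<open>a\<close>, and asks to slide each \<open>b k\<close> inside \<open>A\<close> parallel to
  \<open>L\<close> so that the new points converge to \<open>a\<close> instead.  By compactness any choice of points in
  nearby sections has a subsequence to which this applies.

  If \<open>L\<close> is a hyperplane with normal \<open>n\<close>, only the height \<open>n \<bullet> b k\<close> matters, and every change of
  height that occurs within \<open>A\<close> is realised by moving \<open>a\<close> towards a highest or a lowest point of \<open>A\<close>.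

  If \<open>A\<close> is a P-set, a single direction handles \<open>L\<close> of any dimension: with \<open>u\<close> the
  unit vector along \<open>l - a\<close>, which lies in \<open>L\<close>, slide \<open>b k\<close> along its chord in direction \<open>u\<close>.  The
  two ends of the chord are given by \<open>lower_fun A u\<close> and \<open>- lower_fun A (- u)\<close>, so they depend
  continuously on the base point, and clamping the height \<open>u \<bullet> a\<close> to the chords yields points that
  converge to \<open>a\<close>.
\<close>

definition lifts_sequences :: "'a::real_normed_vector set \<Rightarrow> 'a set \<Rightarrow> bool" where
  "lifts_sequences A L \<longleftrightarrow>
     (\<forall>a\<in>A. \<forall>b l. (\<forall>k::nat. b k \<in> A) \<longrightarrow> b \<longlonglongrightarrow> l \<longrightarrow> l - a \<in> L \<longrightarrow>
        (\<exists>c. (\<forall>k. c k \<in> A \<and> c k - b k \<in> L) \<and> c \<longlonglongrightarrow> a))"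

lemma mem_subspace_section:
  "x \<in> subspace_section A L z \<longleftrightarrow> x \<in> A \<and> x - z \<in> L"
  by (force simp: subspace_section_def image_iff)

lemma set_valued_dom_subspace_section:
  assumes "subspace L"
  shows "set_valued_dom (subspace_section A L) = A + L"
proof -
  have "(\<exists>x. x \<in> A \<and> x - z \<in> L) \<longleftrightarrow> (\<exists>x\<in>A. \<exists>y\<in>L. z = x + y)" for z
    using subspace_neg[OF assms]
    by (metis add_diff_cancel_left' diff_add_cancel minus_diff_eq add.commute)
  then show ?thesis
    by (auto simp: set_valued_dom_def set_plus_def mem_subspace_section set_eq_iff)
qed

section \<open>Sequence lifting along a hyperplane\<close>

lemma lifts_sequences_hyperplane:
  fixes A :: "'a::real_inner set"
  assumes "convex A" "compact A"
  shows "lifts_sequences A {x. n \<bullet> x = 0}"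
  unfolding lifts_sequences_def
proof (intro ballI allI impI)
  fix a l :: 'a and b :: "nat \<Rightarrow> 'a"
  assume a: "a \<in> A" and b: "\<forall>k. b k \<in> A" and lim: "b \<longlonglongrightarrow> l" and l: "l - a \<in> {x. n \<bullet> x = 0}"
  have cont: "continuous_on A (\<lambda>x. n \<bullet> x)"
    by (intro continuous_intros)
  obtain t where t: "t \<in> A" "\<And>x. x \<in> A \<Longrightarrow> n \<bullet> x \<le> n \<bullet> t"
    using continuous_attains_sup[OF assms(2) _ cont] a by blast
  obtain s where s: "s \<in> A" "\<And>x. x \<in> A \<Longrightarrow> n \<bullet> s \<le> n \<bullet> x"
    using continuous_attains_inf[OF assms(2) _ cont] a by blast
  define d where "d k = n \<bullet> b k - n \<bullet> a" for k
  have "(\<lambda>k. n \<bullet> b k - n \<bullet> a) \<longlonglongrightarrow> n \<bullet> l - n \<bullet> a"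
    by (intro tendsto_intros lim)
  then have d0: "d \<longlonglongrightarrow> 0"
    using l by (simp add: d_def[abs_def] inner_diff_right)
  \<comment> \<open>At most one of the two coefficients is nonzero.  If \<open>a\<close> itself is highest (or lowest), the
    corresponding denominator vanishes and division by zero gives the desired coefficient 0.\<close>
  define c where "c k = a + (max 0 (d k) / (n \<bullet> t - n \<bullet> a)) *\<^sub>R (t - a)
                          + (max 0 (- d k) / (n \<bullet> a - n \<bullet> s)) *\<^sub>R (s - a)" for k
  have "c \<longlonglongrightarrow> a + (max 0 0 / (n \<bullet> t - n \<bullet> a)) *\<^sub>R (t - a)
              + (max 0 (- 0) / (n \<bullet> a - n \<bullet> s)) *\<^sub>R (s - a)"
    unfolding c_def divide_inverse by (intro tendsto_intros d0)
  then have "c \<longlonglongrightarrow> a" by simp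
  moreover have "c k \<in> A \<and> c k - b k \<in> {x. n \<bullet> x = 0}" for k
  proof -
    have move: "a + r *\<^sub>R (p - a) \<in> A" if "p \<in> A" "0 \<le> r" "r \<le> 1" for r p
      using convexD_alt[OF assms(1) a that] by (simp add: algebra_simps)
    have bt: "n \<bullet> b k \<le> n \<bullet> t" "n \<bullet> s \<le> n \<bullet> b k" "n \<bullet> a \<le> n \<bullet> t" "n \<bullet> s \<le> n \<bullet> a"
      using b t s a by auto
    show ?thesis
    proof (cases "d k \<ge> 0")
      case True
      then have c: "c k = a + (d k / (n \<bullet> t - n \<bullet> a)) *\<^sub>R (t - a)"
        by (simp add: c_def)
      have "c k \<in> A"
        unfolding c using True bt
        by (intro move t) (auto simp: d_def divide_le_eq_1)
      moreover have "n \<bullet> c k = n \<bullet> b k"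
        using True bt by (auto simp: c d_def inner_diff_right inner_add_right)
      ultimately show ?thesis by (simp add: inner_diff_right)
    next
      case False
      then have c: "c k = a + (- d k / (n \<bullet> a - n \<bullet> s)) *\<^sub>R (s - a)"
        by (simp add: c_def)
      have "c k \<in> A"
        unfolding c using False bt
        by (intro move s) (auto simp: d_def divide_le_eq_1)
      moreover have "n \<bullet> c k = n \<bullet> b k"
        using False bt by (simp add: c d_def inner_diff_right inner_add_right divide_simps)
            (auto simp: algebra_simps)
      ultimately show ?thesis by (simp add: inner_diff_right)
    qed
  qed
  ultimately show "\<exists>c. (\<forall>k. c k \<in> A \<and> c k - b k \<in> {x. n \<bullet> x = 0}) \<and> c \<longlonglongrightarrow> a"
    by blast
qed

lemma hyperplane_of_dim:
  fixes L :: "'a::euclidean_space set"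
  assumes "subspace L" "dim L = DIM('a) - 1"
  obtains n where "L = {x. n \<bullet> x = 0}"
proof -
  have "dim L < DIM('a)"
    using assms(2) DIM_positive[where 'a='a] by linarith
  then obtain n where n: "n \<noteq> 0" "span L \<subseteq> {x. n \<bullet> x = 0}"
    using lowdim_subset_hyperplane by blast
  have "L = {x. n \<bullet> x = 0}"
  proof (rule subspace_dim_equal)
    show "L \<subseteq> {x. n \<bullet> x = 0}"
      using n(2) span_superset by blast
  qed (use assms n(1) in \<open>simp_all add: subspace_hyperplane dim_hyperplane\<close>)
  then show ?thesis by (rule that)
qed

section \<open>Sequence lifting in P-sets\<close>

text \<open>
  The parameters \<open>\<mu>\<close> for which \<open>x + \<mu> *\<^sub>R u\<close> lies in \<open>A\<close> form a closed set.  Since \<open>u\<close> is a unit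
  vector, \<open>\<mu>\<close> is recovered as \<open>u \<bullet> (y - x)\<close> from the point \<open>y\<close>, so this set lies in a continuous image
  of \<open>A\<close> and is compact.
\<close>

lemma lower_fun_attained:
  fixes A :: "'a::real_inner set"
  assumes "compact A" "norm u = 1" "x + \<mu> *\<^sub>R u \<in> A"
  shows "x + lower_fun A u x *\<^sub>R u \<in> A" "lower_fun A u x \<le> \<mu>"
proof -
  define S where "S = {\<nu>. x + \<nu> *\<^sub>R u \<in> A}"
  have uu: "u \<bullet> u = 1"
    using assms(2) by (simp add: norm_eq_1)
  have S: "S = (\<lambda>\<nu>. x + \<nu> *\<^sub>R u) -` A"
    by (auto simp: S_def)
  have "closed S"
    unfolding S using compact_imp_closed[OF assms(1)]
    by (rule closed_vimage) (intro continuous_intros)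
  moreover have "compact ((\<lambda>y. u \<bullet> (y - x)) ` A)"
    using assms(1) by (intro compact_continuous_image continuous_intros)
  moreover have "S \<subseteq> (\<lambda>y. u \<bullet> (y - x)) ` A"
  proof
    fix \<nu> assume "\<nu> \<in> S"
    then show "\<nu> \<in> (\<lambda>y. u \<bullet> (y - x)) ` A"
      by (intro image_eqI[of _ _ "x + \<nu> *\<^sub>R u"]) (simp_all add: S_def uu)
  qed
  ultimately have "compact S"
    by (metis compact_Int_closed inf.absorb_iff2)
  moreover have "S \<noteq> {}"
    using assms(3) by (auto simp: S_def)
  ultimately obtain m where m: "m \<in> S" "\<And>\<nu>. \<nu> \<in> S \<Longrightarrow> m \<le> \<nu>"
    using compact_attains_inf[of S] by (metis (no_types))
  have "lower_fun A u x = m"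
    unfolding lower_fun_def using m by (intro Least_equality) (auto simp: S_def)
  then show "x + lower_fun A u x *\<^sub>R u \<in> A" "lower_fun A u x \<le> \<mu>"
    using m assms(3) by (auto simp: S_def)
qed

text \<open>
  It is enough to slide along the single direction \<open>u\<close> from \<open>a\<close> to \<open>l\<close>: the chords of \<open>A\<close> in this
  direction through \<open>l\<close> and through \<open>a\<close> coincide, and by the P-set property the chords through
  \<open>b k\<close> converge to that common chord.
\<close>

lemma P_set_lifts_sequences:
  fixes A :: "'a::real_inner set"
  assumes "P_set A" "subspace L"
  shows "lifts_sequences A L"
  unfolding lifts_sequences_def
proof (intro ballI allI impI)
  fix a l :: 'a and b :: "nat \<Rightarrow> 'a"
  assume a: "a \<in> A" and b: "\<forall>k. b k \<in> A" and lim: "b \<longlonglongrightarrow> l" and l: "l - a \<in> L"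
  have "convex A" "compact A"
    using assms(1) by (auto simp: P_set_def)
  have "l \<in> A"
    using closed_sequentially[OF compact_imp_closed[OF \<open>compact A\<close>]] b lim by blast
  show "\<exists>c. (\<forall>k. c k \<in> A \<and> c k - b k \<in> L) \<and> c \<longlonglongrightarrow> a"
  proof (cases "l = a")
    case True
    then show ?thesis
      using b lim subspace_0[OF assms(2)] by (intro exI[of _ b]) auto
  next
    case False
    define u where "u = sgn (l - a)"
    have u: "norm u = 1"
      using False by (simp add: u_def norm_sgn)
    then have uu: "u \<bullet> u = 1"
      by (simp add: norm_eq_1)
    have uL: "r *\<^sub>R u \<in> L" for r
      using subspace_scale[OF assms(2) l] by (simp add: u_def sgn_div_norm)
    define x where "x k = proj_orth u (b k)" for k
    have split: "proj_orth u z + (u \<bullet> z) *\<^sub>R u = z" for z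
      by (simp add: proj_orth_def)
    have split': "proj_orth u z + (- (u \<bullet> z)) *\<^sub>R (- u) = z" for z
      by (simp add: proj_orth_def)
    have flip: "proj_orth (- u) = proj_orth u"
      by (simp add: proj_orth_def fun_eq_iff)
    have la: "proj_orth u l = proj_orth u a"
    proof -
      have "l = a + norm (l - a) *\<^sub>R u"
        using False by (simp add: u_def sgn_div_norm)
      moreover have "proj_orth u (a + r *\<^sub>R u) = proj_orth u a" for r
        by (simp add: proj_orth_def inner_add_right uu scaleR_left_distrib)
      ultimately show ?thesis by metis
    qed
    have "(\<lambda>k. proj_orth u (b k)) \<longlonglongrightarrow> proj_orth u l"
      unfolding proj_orth_def by (intro tendsto_intros lim)
    then have x_lim: "x \<longlonglongrightarrow> proj_orth u a"
      by (simp add: x_def[abs_def] la)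
    have end_lim: "(\<lambda>k. lower_fun A v (x k)) \<longlonglongrightarrow> lower_fun A v (proj_orth u a)"
      if "v = u \<or> v = - u" for v
    proof (rule continuous_on_tendsto_compose[where s = "proj_orth u ` A"])
      show "continuous_on (proj_orth u ` A) (lower_fun A v)"
        using assms(1) u that flip unfolding P_set_def by (metis norm_minus_cancel)
    qed (use x_lim a b in \<open>auto simp: x_def[abs_def]\<close>)
    \<comment> \<open>The chord through \<open>b k\<close> consists of the points \<open>x k + \<mu> *\<^sub>R u\<close> with \<open>lo k \<le> \<mu> \<le> hi k\<close>; its upper
      end is its lower end seen in the direction \<open>- u\<close>.\<close>
    define lo hi where "lo k = lower_fun A u (x k)" and "hi k = - lower_fun A (- u) (x k)" for k
    have bounds: "lower_fun A u (proj_orth u z) \<le> u \<bullet> z"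
        "u \<bullet> z \<le> - lower_fun A (- u) (proj_orth u z)"
        "proj_orth u z + lower_fun A u (proj_orth u z) *\<^sub>R u \<in> A"
        "proj_orth u z + (- lower_fun A (- u) (proj_orth u z)) *\<^sub>R u \<in> A" if "z \<in> A" for z
      using lower_fun_attained[OF \<open>compact A\<close> u, of "proj_orth u z" "u \<bullet> z"]
        lower_fun_attained[OF \<open>compact A\<close>, of "- u" "proj_orth u z" "- (u \<bullet> z)"]
        split split' that u by auto
    define m where "m k = max (lo k) (min (hi k) (u \<bullet> a))" for k
    define c where "c k = x k + m k *\<^sub>R u" for k
    have "m \<longlonglongrightarrow> max (lower_fun A u (proj_orth u a))
                    (min (- lower_fun A (- u) (proj_orth u a)) (u \<bullet> a))"
      unfolding m_def lo_def hi_def by (intro tendsto_intros end_lim) auto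
    then have "m \<longlonglongrightarrow> u \<bullet> a"
      using bounds(1,2)[OF a] by (simp add: max_def min_def split: if_splits)
    then have "c \<longlonglongrightarrow> proj_orth u a + (u \<bullet> a) *\<^sub>R u"
      unfolding c_def by (intro tendsto_intros x_lim)
    then have "c \<longlonglongrightarrow> a"
      by (simp add: split)
    moreover have "c k \<in> A \<and> c k - b k \<in> L" for k
    proof
      have bk: "b k \<in> A" using b by blast
      have le: "lo k \<le> m k" "m k \<le> hi k"
        using bounds(1,2)[OF bk] by (auto simp: m_def lo_def hi_def x_def)
      have "(\<lambda>\<mu>. x k + \<mu> *\<^sub>R u) -` A = (\<lambda>\<mu>. \<mu> *\<^sub>R u) -` ((+) (- x k) ` A)"
        by (force simp: image_iff)
      then have "convex ((\<lambda>\<mu>. x k + \<mu> *\<^sub>R u) -` A)"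
        using convex_linear_vimage[of "\<lambda>\<mu>. \<mu> *\<^sub>R u"] convex_translation[OF \<open>convex A\<close>]
        by (simp add: linear_scaleR_left)
      then have "is_interval ((\<lambda>\<mu>. x k + \<mu> *\<^sub>R u) -` A)"
        by (simp add: is_interval_convex_1)
      then show "c k \<in> A"
        using bounds(3,4)[OF bk] mem_is_interval_1_I[OF _ _ _ le, of "(\<lambda>\<mu>. x k + \<mu> *\<^sub>R u) -` A"]
        by (simp add: c_def lo_def hi_def x_def)
      have "c k - b k = (m k - u \<bullet> b k) *\<^sub>R u"
        by (simp add: c_def x_def proj_orth_def algebra_simps)
      then show "c k - b k \<in> L"
        by (simp add: uL)
    qed
    ultimately show ?thesis by blast
  qed
qed

section \<open>Hausdorff continuity of the sections\<close>

lemma limit_in_subspace_section: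
  fixes A :: "'a::real_normed_vector set"
  assumes "closed A" "closed L" "\<And>k. x k \<in> subspace_section A L (w k)"
    and "x \<longlonglongrightarrow> p" "w \<longlonglongrightarrow> z"
  shows "p \<in> subspace_section A L z"
proof -
  have "(\<lambda>k. x k - w k) \<longlonglongrightarrow> p - z"
    by (intro tendsto_intros assms)
  moreover have "\<forall>k. x k \<in> A" "\<forall>k. x k - w k \<in> L"
    using assms(3) by (simp_all add: mem_subspace_section)
  ultimately show ?thesis
    using closed_sequentially[OF assms(1) _ assms(4)]
      closed_sequentially[OF assms(2), of "\<lambda>k. x k - w k"]
    unfolding mem_subspace_section by blast
qed

lemma mem_plus_cball:
  fixes x :: "'a::real_normed_vector"
  assumes "y \<in> B" "dist x y \<le> e"
  shows "x \<in> B + cball 0 e"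
  using assms set_plus_intro[of y B "x - y" "cball 0 e"] by (simp add: dist_norm norm_minus_commute)

lemma sequence_of_failures:
  fixes z :: "'a::metric_space"
  assumes "\<not> (\<exists>\<delta>>0. \<forall>w\<in>D. dist w z < \<delta> \<longrightarrow> P w)"
  obtains w :: "nat \<Rightarrow> 'a" where "\<And>k. w k \<in> D" "\<And>k. \<not> P (w k)" "w \<longlonglongrightarrow> z"
proof -
  have "\<forall>k::nat. \<exists>w. w \<in> D \<and> dist w z < inverse (real (Suc k)) \<and> \<not> P w"
  proof
    fix k :: nat
    have "inverse (real (Suc k)) > 0" by simp
    then show "\<exists>w. w \<in> D \<and> dist w z < inverse (real (Suc k)) \<and> \<not> P w"
      using assms by blast
  qed
  then obtain w where w: "\<And>k::nat. w k \<in> D \<and> dist (w k) z < inverse (real (Suc k)) \<and> \<not> P (w k)"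
    by metis
  have "(\<lambda>k. dist (w k) z) \<longlonglongrightarrow> 0"
    by (rule tendsto_sandwich[OF _ _ tendsto_const LIMSEQ_inverse_real_of_nat])
       (use w in \<open>auto intro!: always_eventually less_imp_le\<close>)
  then have "w \<longlonglongrightarrow> z"
    by (rule iffD2[OF tendsto_dist_iff])
  then show ?thesis
    using w that by blast
qed

lemma subspace_section_upper_semicontinuous:
  fixes A :: "'a::real_normed_vector set"
  assumes "compact A" "closed L" "e > 0"
  shows "\<exists>\<delta>>0. \<forall>w\<in>D. dist w z < \<delta> \<longrightarrow>
           subspace_section A L w \<subseteq> subspace_section A L z + cball 0 e"
proof (rule ccontr)
  assume "\<not> ?thesis"
  then obtain w where "\<And>k::nat. w k \<in> D"
    and w: "\<And>k. \<not> subspace_section A L (w k) \<subseteq> subspace_section A L z + cball 0 e"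
    and wz: "w \<longlonglongrightarrow> z"
    by (rule sequence_of_failures) blast
  then have "\<forall>k. \<exists>x. x \<in> subspace_section A L (w k) \<and> x \<notin> subspace_section A L z + cball 0 e"
    by blast
  then obtain x where x: "\<And>k. x k \<in> subspace_section A L (w k)"
    and far: "\<And>k. x k \<notin> subspace_section A L z + cball 0 e"
    by metis
  have "\<forall>k. x k \<in> A"
    using x by (simp add: mem_subspace_section)
  then obtain p r where r: "strict_mono r" "(x \<circ> r) \<longlonglongrightarrow> p"
    using assms(1) unfolding compact_def by metis
  have "p \<in> subspace_section A L z"
    using limit_in_subspace_section[OF compact_imp_closed[OF assms(1)] assms(2) _ r(2)
        LIMSEQ_subseq_LIMSEQ[OF wz r(1)]] x by simp
  moreover have "\<forall>\<^sub>F k in sequentially. dist (x (r k)) p < e"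
    using tendstoD[OF r(2) assms(3)] by simp
  then obtain k where "dist (x (r k)) p < e"
    by (meson eventually_happens trivial_limit_sequentially)
  ultimately show False
    using far mem_plus_cball by (metis less_imp_le)
qed

text \<open>
  If the points \<open>a k\<close> of the fixed section stay away from the sections through \<open>w k\<close>, pass to a
  subsequence along which both \<open>a k\<close> and arbitrary points of the nearby sections converge.  Lifting
  the latter to the limit of \<open>a k\<close> gives points of the nearby sections that come close to \<open>a k\<close>.
\<close>

lemma subspace_section_lower_semicontinuous:
  fixes A :: "'a::real_normed_vector set"
  assumes "compact A" "closed L" "subspace L" "lifts_sequences A L" "e > 0"
  shows "\<exists>\<delta>>0. \<forall>w\<in>set_valued_dom (subspace_section A L). dist w z < \<delta> \<longrightarrow>
           subspace_section A L z \<subseteq> subspace_section A L w + cball 0 e"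
proof (rule ccontr)
  assume "\<not> ?thesis"
  then obtain w where dom: "\<And>k::nat. w k \<in> set_valued_dom (subspace_section A L)"
    and w: "\<And>k. \<not> subspace_section A L z \<subseteq> subspace_section A L (w k) + cball 0 e"
    and wz: "w \<longlonglongrightarrow> z"
    by (rule sequence_of_failures) blast
  have "\<forall>k. \<exists>x. x \<in> subspace_section A L (w k)"
    using dom by (auto simp: set_valued_dom_def)
  then obtain b where b: "\<And>k. b k \<in> subspace_section A L (w k)"
    by metis
  have "\<forall>k. \<exists>x. x \<in> subspace_section A L z \<and> x \<notin> subspace_section A L (w k) + cball 0 e"
    using w by blast
  then obtain a where a: "\<And>k. a k \<in> subspace_section A L z"
    and far: "\<And>k. a k \<notin> subspace_section A L (w k) + cball 0 e"
    by metis
  have "\<forall>k. (a k, b k) \<in> A \<times> A"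
    using a b by (simp add: mem_subspace_section)
  then obtain pq r where r: "strict_mono r" and pq: "((\<lambda>k. (a k, b k)) \<circ> r) \<longlonglongrightarrow> pq"
    by (rule seq_compactE[OF compact_imp_seq_compact[OF compact_Times[OF assms(1) assms(1)]]])
  obtain p q where "pq = (p, q)"
    by (cases pq)
  with pq have ap: "(a \<circ> r) \<longlonglongrightarrow> p" and bq: "(b \<circ> r) \<longlonglongrightarrow> q"
    using tendsto_fst[OF pq] tendsto_snd[OF pq] by (simp_all add: o_def)
  have "closed A"
    using assms(1) by (rule compact_imp_closed)
  have p: "p \<in> subspace_section A L z"
    using limit_in_subspace_section[OF \<open>closed A\<close> assms(2) _ ap tendsto_const] a by simp
  have q: "q \<in> subspace_section A L z"
    using limit_in_subspace_section[OF \<open>closed A\<close> assms(2) _ bq LIMSEQ_subseq_LIMSEQ[OF wz r]] b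
    by simp
  have "q - p \<in> L"
    using subspace_diff[OF assms(3), of "q - z" "p - z"] p q by (simp add: mem_subspace_section)
  moreover have "p \<in> A" "\<forall>k. (b \<circ> r) k \<in> A"
    using p b by (simp_all add: mem_subspace_section)
  ultimately obtain c where c: "\<And>k. c k \<in> A" "\<And>k. c k - b (r k) \<in> L" and cp: "c \<longlonglongrightarrow> p"
    using assms(4) bq unfolding lifts_sequences_def by (metis comp_apply)
  have c_sec: "c k \<in> subspace_section A L (w (r k))" for k
    using subspace_add[OF assms(3) c(2), of "b (r k) - w (r k)" k] b[of "r k"] c(1)
    by (simp add: mem_subspace_section)
  have "(\<lambda>k. dist ((a \<circ> r) k) (c k)) \<longlonglongrightarrow> dist p p"
    by (intro tendsto_intros ap cp)
  then have "\<forall>\<^sub>F k in sequentially. dist (a (r k)) (c k) < e"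
    using order_tendstoD(2)[of _ 0 sequentially e] assms(5) by simp
  then obtain k where "dist (a (r k)) (c k) < e"
    by (meson eventually_happens trivial_limit_sequentially)
  then show False
    using far c_sec mem_plus_cball by (metis less_imp_le)
qed

lemma hausdorff_dist_le:
  assumes "h > 0" "A \<subseteq> B + cball 0 h" "B \<subseteq> A + cball 0 h"
  shows "hausdorff_dist A B \<le> h"
  unfolding hausdorff_dist_def
  by (rule cInf_lower) (use assms in \<open>auto intro!: bdd_belowI[of _ 0]\<close>)

lemma lifts_sequences_hausdorff_continuous:
  fixes A :: "'a::real_normed_vector set"
  assumes "compact A" "closed L" "subspace L" "lifts_sequences A L"
  shows "hausdorff_continuous_on (set_valued_dom (subspace_section A L)) (subspace_section A L)"
    (is "hausdorff_continuous_on ?D ?F")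
  unfolding hausdorff_continuous_on_def
proof (intro ballI allI impI)
  fix z and \<epsilon> :: real
  assume "\<epsilon> > 0"
  then have e: "\<epsilon> / 2 > 0" by simp
  obtain \<delta>1 where \<delta>1: "\<delta>1 > 0" "\<forall>w\<in>?D. dist w z < \<delta>1 \<longrightarrow> ?F w \<subseteq> ?F z + cball 0 (\<epsilon> / 2)"
    using subspace_section_upper_semicontinuous[OF assms(1,2) e] by blast
  obtain \<delta>2 where \<delta>2: "\<delta>2 > 0" "\<forall>w\<in>?D. dist w z < \<delta>2 \<longrightarrow> ?F z \<subseteq> ?F w + cball 0 (\<epsilon> / 2)"
    using subspace_section_lower_semicontinuous[OF assms e] by blast
  have "hausdorff_dist (?F w) (?F z) < \<epsilon>" if "w \<in> ?D" "dist w z < min \<delta>1 \<delta>2" for w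
    using hausdorff_dist_le[OF e, of "?F w" "?F z"] \<delta>1(2) \<delta>2(2) that \<open>\<epsilon> > 0\<close> by fastforce
  then show "\<exists>\<delta>>0. \<forall>w\<in>?D. dist w z < \<delta> \<longrightarrow> hausdorff_dist (?F w) (?F z) < \<epsilon>"
    using \<delta>1(1) \<delta>2(1) by (intro exI[of _ "min \<delta>1 \<delta>2"]) auto
qed

theorem theorem2p4:
  fixes A L :: "(real ^ 'n) set"
  assumes "convex A" and "compact A"
    and "subspace L"
    and "dim L = CARD('n) - 1 \<or> P_set A"
  shows "set_valued_dom (subspace_section A L) = A + L \<and>
         hausdorff_continuous_on (set_valued_dom (subspace_section A L)) (subspace_section A L)"
proof -
  have "lifts_sequences A L"
    using assms(4)
  proof
    assume "dim L = CARD('n) - 1"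
    then have "dim L = DIM(real ^ 'n) - 1" by simp
    then obtain n where "L = {x. n \<bullet> x = 0}"
      using hyperplane_of_dim[OF assms(3)] by blast
    then show ?thesis
      using lifts_sequences_hyperplane[OF assms(1,2)] by simp
  next
    assume "P_set A"
    then show ?thesis
      using assms(3) by (rule P_set_lifts_sequences)
  qed
  then show ?thesis
    using set_valued_dom_subspace_section[OF assms(3)]
      lifts_sequences_hausdorff_continuous[OF assms(2) closed_subspace[OF assms(3)] assms(3)]
    by blast
qed

end
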